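(* Let $D\ge 1$ be an integer, let $\mathcal{H}_1,\mathcal{H}_2$ be $D$-dimensional complex Hilbert spaces, let $|\Psi_0\rangle\in\mathcal{H}_1\otimes\mathcal{H}_2$ be a maximally entangled state, let $\{|k\rangle\}_{k=0}^{D-1}$ be an orthonormal basis of $\mathcal{H}_1$, and let $\omega=e^{2\pi i/D}$. Let $N\ge 1$ and for $j=0,\dots,N-1$ define $$U_j=\sum_{k=0}^{D-1}\omega^{jk}|k\rangle\langle k|,\qquad |\Psi_j\rangle=(U_j\otimes I)|\Psi_0\rangle .$$ Then the set of maximally entangled states $\{|\Psi_j\rangle\}_{j=0}^{N-1}$ is locally copiable.
   Context: A maximally entangled state in $\mathcal{H}_1\otimes\mathcal{H}_2$ (both of dimension $D$) is a unit vector of the form $\frac{1}{\sqrt D}\sum_{k=0}^{D-1}|e_k\rangle\otimes|f_k\rangle$ with $\{|e_k\rangle\}$, $\{|f_k\rangle\}$ orthonormal bases of $\mathcal{H}_1$, $\mathcal{H}_2$. Local copiability: let $\mathcal{H}_3\cong\mathcal{H}_1$ and $\mathcal{H}_4\cong\mathcal{H}_2$ be further copies (fixed identifications), so each is $D$-dimensional. Alice holds $\mathcal{H}_A=\mathcal{H}_1\otimes\mathcal{H}_3$ and Bob holds $\mathcal{H}_B=\mathcal{H}_2\otimes\mathcal{H}_4$. For $|\Psi_j\rangle\in\mathcal{H}_1\otimes\mathcal{H}_2$ write $|\Psi_j^{12}\rangle$ for this vector and $|\Psi_j^{34}\rangle$ for the corresponding vector in $\mathcal{H}_3\otimes\mathcal{H}_4$.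 A set $\{|\Psi_j\rangle\}_{j=0}^{N-1}$ is locally copiable if there exist a state (unit vector) $|b^{34}\rangle\in\mathcal{H}_3\otimes\mathcal{H}_4$ (the blank state) and a deterministic (trace-preserving) operation $\Lambda$ on $\mathcal{H}_A\otimes\mathcal{H}_B$ implementable by local operations and classical communication (LOCC) between Alice and Bob such that for all $j=0,\dots,N-1$ $$\Lambda\big(|\Psi_j^{12}\rangle\langle\Psi_j^{12}|\otimes|b^{34}\rangle\langle b^{34}|\big)=|\Psi_j^{12}\rangle\langle\Psi_j^{12}|\otimes|\Psi_j^{34}\rangle\langle\Psi_j^{34}|.$$ *)

theory Defs
  imports Complex_Main "Jordan_Normal_Form.Schur_Decomposition" "Jordan_Normal_Form.VS_Connect"
begin

text \<open>A \<open>D\<close>-dimensional Hilbert space is \<open>carrier_vec D :: complex vec set\<close>, with the inner product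
  \<open>\<bullet>c\<close>. The product basis vector with labels \<open>i\<close> and \<open>j\<close> of a space of dimension \<open>m\<close> tensored with
  one of dimension \<open>n\<close> has the index \<open>i * n + j\<close>.\<close>

definition tensor_vec :: "complex vec \<Rightarrow> complex vec \<Rightarrow> complex vec" where
  "tensor_vec v w = vec (dim_vec v * dim_vec w)
     (\<lambda>i. v $ (i div dim_vec w) * w $ (i mod dim_vec w))"

definition tensor_mat :: "complex mat \<Rightarrow> complex mat \<Rightarrow> complex mat" where
  "tensor_mat A B = mat (dim_row A * dim_row B) (dim_col A * dim_col B)
     (\<lambda>(i, j). A $$ (i div dim_row B, j div dim_col B) * B $$ (i mod dim_row B, j mod dim_col B))"

text \<open>The sum over \<open>k < n\<close> of matrices of format \<open>r \<times> c\<close>.\<close>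

definition msum :: "nat \<Rightarrow> nat \<Rightarrow> (nat \<Rightarrow> complex mat) \<Rightarrow> nat \<Rightarrow> complex mat" where
  "msum r c M n = mat r c (\<lambda>(i, j). \<Sum>k<n. M k $$ (i, j))"

text \<open>\<open>ketbra v w\<close> is the operator \<open>|v\<rangle>\<langle>w|\<close>.\<close>

definition ketbra :: "complex vec \<Rightarrow> complex vec \<Rightarrow> complex mat" where
  "ketbra v w = mat (dim_vec v) (dim_vec w) (\<lambda>(i, j). v $ i * cnj (w $ j))"

definition orthonormal_basis :: "nat \<Rightarrow> (nat \<Rightarrow> complex vec) \<Rightarrow> bool" where
  "orthonormal_basis D e \<longleftrightarrow>
     (\<forall>i<D. e i \<in> carrier_vec D) \<and>
     (\<forall>i<D. \<forall>j<D. e i \<bullet>c e j = (if i = j then 1 else 0)) \<and>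
     vectorspace.basis class_ring (module_vec TYPE(complex) D) (e ` {..<D})"

definition maximally_entangled :: "nat \<Rightarrow> complex vec \<Rightarrow> bool" where
  "maximally_entangled D \<psi> \<longleftrightarrow>
     (\<exists>e f. orthonormal_basis D e \<and> orthonormal_basis D f \<and>
        \<psi> = complex_of_real (1 / sqrt (real D)) \<cdot>\<^sub>v
              finsum_vec TYPE(complex) (D * D) (\<lambda>k. tensor_vec (e k) (f k)) {..<D})"

text \<open>\<open>locc a b a' b' \<Lambda>\<close>: the map \<open>\<Lambda>\<close>, from operators on a space of dimensions \<open>a\<close> (Alice) and
  \<open>b\<close> (Bob) to operators on one of dimensions \<open>a'\<close> and \<open>b'\<close>, is the overall (deterministic) effect
  of an LOCC protocol with finitely many rounds. In each round one party performs a local measurement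
  with Kraus operators \<open>K k\<close>, where the completeness relation \<open>\<Sum>\<^sub>k K\<^sub>k\<^sup>\<dagger> K\<^sub>k = 1\<close> expresses trace
  preservation; the outcome \<open>k\<close> is communicated, and the rest \<open>\<Lambda> k\<close> of the protocol may depend on it.
  The output dimension of \<open>K k\<close> is arbitrary, so ancillas may be added and subsystems discarded.
  A general local instrument, with several Kraus operators for one announced outcome, is obtained by
  choosing the same continuation for these operators.\<close>

inductive locc :: "nat \<Rightarrow> nat \<Rightarrow> nat \<Rightarrow> nat \<Rightarrow> (complex mat \<Rightarrow> complex mat) \<Rightarrow> bool" where
  stop: "locc a b a b (\<lambda>\<rho>. \<rho>)"
| alice: "locc a b a' b'
      (\<lambda>\<rho>. msum (a' * b') (a' * b')
        (\<lambda>k. \<Lambda> k (tensor_mat (K k) (1\<^sub>m b) * \<rho> * mat_adjoint (tensor_mat (K k) (1\<^sub>m b)))) n)"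
  if "\<And>k. k < n \<Longrightarrow> K k \<in> carrier_mat (d k) a"
    and "msum a a (\<lambda>k. mat_adjoint (K k) * K k) n = 1\<^sub>m a"
    and "\<And>k. k < n \<Longrightarrow> locc (d k) b a' b' (\<Lambda> k)"
| bob: "locc a b a' b'
      (\<lambda>\<rho>. msum (a' * b') (a' * b')
        (\<lambda>k. \<Lambda> k (tensor_mat (1\<^sub>m a) (K k) * \<rho> * mat_adjoint (tensor_mat (1\<^sub>m a) (K k)))) n)"
  if "\<And>k. k < n \<Longrightarrow> K k \<in> carrier_mat (d k) b"
    and "msum b b (\<lambda>k. mat_adjoint (K k) * K k) n = 1\<^sub>m b"
    and "\<And>k. k < n \<Longrightarrow> locc a (d k) a' b' (\<Lambda> k)"

text \<open>The canonical identification of operators on \<open>(H\<^sub>1 \<otimes> H\<^sub>2) \<otimes> (H\<^sub>3 \<otimes> H\<^sub>4)\<close> with operators on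
  \<open>(H\<^sub>1 \<otimes> H\<^sub>3) \<otimes> (H\<^sub>2 \<otimes> H\<^sub>4)\<close>: exchange the middle two of the four base-\<open>D\<close> digits of row and
  column indices.\<close>

definition swap_middle :: "nat \<Rightarrow> nat \<Rightarrow> nat" where
  "swap_middle D i =
     (((i div D ^ 3) * D + (i div D) mod D) * D + (i div D ^ 2) mod D) * D + i mod D"

definition regroup :: "nat \<Rightarrow> complex mat \<Rightarrow> complex mat" where
  "regroup D M = mat (D ^ 4) (D ^ 4) (\<lambda>(i, j). M $$ (swap_middle D i, swap_middle D j))"

definition locally_copiable :: "nat \<Rightarrow> nat \<Rightarrow> (nat \<Rightarrow> complex vec) \<Rightarrow> bool" where
  "locally_copiable D N \<Psi> \<longleftrightarrow>
     (\<exists>b \<Lambda>. b \<in> carrier_vec (D * D) \<and> b \<bullet>c b = 1 \<and>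
        locc (D * D) (D * D) (D * D) (D * D) \<Lambda> \<and>
        (\<forall>j<N. \<Lambda> (regroup D (tensor_mat (ketbra (\<Psi> j) (\<Psi> j)) (ketbra b b))) =
               regroup D (tensor_mat (ketbra (\<Psi> j) (\<Psi> j)) (ketbra (\<Psi> j) (\<Psi> j)))))"

end

theory Submission
  imports Defs
begin

text \<open>Identify a vector of \<open>H\<^sub>1 \<otimes> H\<^sub>2\<close> with its coefficient matrix. Maximally entangled states are then
  the matrices \<open>W / \<surd>D\<close> with \<open>W\<close> unitary, a local operator \<open>A \<otimes> B\<close> acts by \<open>X \<mapsto> A X B\<^sup>T\<close>, and
  regrouping the product state of \<open>X\<close> and \<open>Y\<close> gives the Kronecker product of \<open>X\<close> and \<open>Y\<close>. Take
  \<open>\<Psi>\<^sub>0\<close>, with matrix \<open>W / \<surd>D\<close>, as the blank state and let Alice apply the controlled shift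
  \<open>A: |k\<rangle>|l\<rangle> \<mapsto> |k - l\<rangle>|l\<rangle>\<close> in the given basis. As \<open>\<omega>\<^sup>D = 1\<close>, \<open>A (U\<^sub>j \<otimes> 1) = (U\<^sub>j \<otimes> U\<^sub>j) A\<close>. If Bob
  applies the unitary \<open>B\<close> with \<open>B\<^sup>T = (W \<otimes> W)\<^sup>\<dagger> A\<^sup>\<dagger> (W \<otimes> W)\<close>, then
  \<open>A (U\<^sub>j W \<otimes> W) B\<^sup>T = A (U\<^sub>j \<otimes> 1) A\<^sup>\<dagger> (W \<otimes> W) = U\<^sub>j W \<otimes> U\<^sub>j W\<close>.\<close>

section \<open>Sums and two-digit indices over products of ranges\<close>

lemma sum_lessThan_times:
  fixes f :: "nat \<Rightarrow> 'a::comm_monoid_add"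
  shows "(\<Sum>k<m * n. f k) = (\<Sum>i<m. \<Sum>j<n. f (i * n + j))"
proof -
  have "(\<Sum>j<n. f (i * n + j)) = sum f {i * n..<i * n + n}" for i
    using sum.shift_bounds_nat_ivl[of f 0 "i * n" n] by (simp add: atLeast0LessThan add.commute)
  then show ?thesis
    by (simp flip: sum.nat_group)
qed

lemma div_less_of_less_mult: "i div n < m" if "i < m * n" for i m n :: nat
  using that by (simp add: less_mult_imp_div_less)

lemma mod_less_of_less_mult: "i mod n < n" if "i < m * n" for i m n :: nat
  using that by (cases n) auto

lemmas div_mod_less = div_less_of_less_mult mod_less_of_less_mult

lemma mult_add_less: "i * n + j < m * n" if "i < m" "j < n" for i j m n :: nat
proof -
  have "i * n + j < Suc i * n" using that by simp
  also have "\<dots> \<le> m * n" using that by (intro mult_le_mono1) simp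
  finally show ?thesis .
qed

subsection \<open>Adjoints and unitary matrices\<close>

lemma mat_adjoint_eq:
  "mat_adjoint (A :: complex mat) = mat (dim_col A) (dim_row A) (\<lambda>(i, j). cnj (A $$ (j, i)))"
  by (rule eq_matI) (auto simp: mat_adjoint_def mat_of_rows_def)

lemma index_mat_adjoint [simp]:
  "i < dim_col A \<Longrightarrow> j < dim_row A \<Longrightarrow> mat_adjoint (A :: complex mat) $$ (i, j) = cnj (A $$ (j, i))"
  "dim_row (mat_adjoint A) = dim_col A"
  "dim_col (mat_adjoint A) = dim_row A"
  by (simp_all add: mat_adjoint_eq)

lemma mat_adjoint_carrier [simp]:
  "A \<in> carrier_mat m n \<Longrightarrow> mat_adjoint (A :: complex mat) \<in> carrier_mat n m"
  by (auto simp: mat_adjoint_eq)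

lemma mat_adjoint_adjoint [simp]: "mat_adjoint (mat_adjoint A) = (A :: complex mat)"
  by (rule eq_matI) auto

lemma index_mult_mat_sum:
  assumes "A \<in> carrier_mat m n" "B \<in> carrier_mat n p" "i < m" "j < p"
  shows "(A * B) $$ (i, j) = (\<Sum>k<n. A $$ (i, k) * B $$ (k, j))"
  using assms by (auto simp: scalar_prod_def atLeast0LessThan)

lemma mat_adjoint_mult:
  assumes "A \<in> carrier_mat m n" "B \<in> carrier_mat n p"
  shows "mat_adjoint (A * B) = mat_adjoint B * mat_adjoint (A :: complex mat)"
proof (rule eq_matI)
  fix i j assume "i < dim_row (mat_adjoint B * mat_adjoint A)" "j < dim_col (mat_adjoint B * mat_adjoint A)"
  then show "mat_adjoint (A * B) $$ (i, j) = (mat_adjoint B * mat_adjoint A) $$ (i, j)"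
    using assms by (auto simp: scalar_prod_def mult.commute)
qed (use assms in auto)

lemma mat_adjoint_transpose: "mat_adjoint (A\<^sup>T) = (mat_adjoint (A :: complex mat))\<^sup>T"
  by (rule eq_matI) auto

definition unitary_mat :: "nat \<Rightarrow> complex mat \<Rightarrow> bool" where
  "unitary_mat n W \<longleftrightarrow> W \<in> carrier_mat n n \<and> mat_adjoint W * W = 1\<^sub>m n"

text \<open>For a square matrix a left inverse is also a right inverse, which gives the second
  product.\<close>

lemma unitary_matD:
  assumes "unitary_mat n W"
  shows "W \<in> carrier_mat n n" "mat_adjoint W * W = 1\<^sub>m n" "W * mat_adjoint W = 1\<^sub>m n"
  using assms mat_mult_left_right_inverse[of "mat_adjoint W" n W] by (auto simp: unitary_mat_def)

lemma unitary_mat_one: "unitary_mat n (1\<^sub>m n)"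
proof -
  have "mat_adjoint (1\<^sub>m n) = (1\<^sub>m n :: complex mat)"
    by (rule eq_matI) auto
  then show ?thesis by (simp add: unitary_mat_def)
qed

lemma unitary_mat_adjoint:
  assumes "unitary_mat n W"
  shows "unitary_mat n (mat_adjoint W)"
  unfolding unitary_mat_def mat_adjoint_adjoint
  using unitary_matD(3)[OF assms] mat_adjoint_carrier[OF unitary_matD(1)[OF assms]] by simp

lemma unitary_mat_transpose:
  assumes "unitary_mat n W"
  shows "unitary_mat n (W\<^sup>T)"
proof -
  note W = unitary_matD[OF assms]
  have "mat_adjoint (W\<^sup>T) * W\<^sup>T = (W * mat_adjoint W)\<^sup>T"
    using W(1) by (simp add: mat_adjoint_transpose transpose_mult[of _ n n _ n])
  then show ?thesis using W by (simp add: unitary_mat_def)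
qed

lemma unitary_mat_mult:
  assumes "unitary_mat n V" "unitary_mat n W"
  shows "unitary_mat n (V * W)"
proof -
  note V = unitary_matD[OF assms(1)] and W = unitary_matD[OF assms(2)]
  have "mat_adjoint (V * W) * (V * W) = mat_adjoint W * (mat_adjoint V * V) * W"
    using V(1) W(1) by (simp add: mat_adjoint_mult[of _ n n _ n] assoc_mult_mat[of _ n n _ n _ n]
       mult_carrier_mat[of _ n n])
  then show ?thesis using V W by (simp add: unitary_mat_def)
qed

subsection \<open>Kronecker products\<close>

lemma dim_tensor_mat [simp]:
  "dim_row (tensor_mat A B) = dim_row A * dim_row B"
  "dim_col (tensor_mat A B) = dim_col A * dim_col B"
  by (simp_all add: tensor_mat_def)

lemma tensor_mat_carrier [simp]:
  "A \<in> carrier_mat m n \<Longrightarrow> B \<in> carrier_mat p q \<Longrightarrow> tensor_mat A B \<in> carrier_mat (m * p) (n * q)"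
  by auto

lemma index_tensor_mat:
  assumes "A \<in> carrier_mat m n" "B \<in> carrier_mat p q" "i < m * p" "j < n * q"
  shows "tensor_mat A B $$ (i, j) = A $$ (i div p, j div q) * B $$ (i mod p, j mod q)"
  using assms by (auto simp: tensor_mat_def)

text \<open>The summation index \<open>k < n * q\<close> splits into two independent digits, so the
  double sum factors into the entries of the two products.\<close>

lemma tensor_mat_mult:
  assumes "A \<in> carrier_mat m n" "B \<in> carrier_mat p q" "C \<in> carrier_mat n r" "D \<in> carrier_mat q s"
  shows "tensor_mat A B * tensor_mat C D = tensor_mat (A * C) (B * D)"
proof (rule eq_matI)
  fix i j assume "i < dim_row (tensor_mat (A * C) (B * D))" "j < dim_col (tensor_mat (A * C) (B * D))"
  then have i: "i < m * p" and j: "j < r * s" using assms by auto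
  have "(tensor_mat A B * tensor_mat C D) $$ (i, j)
      = (\<Sum>k<n * q. tensor_mat A B $$ (i, k) * tensor_mat C D $$ (k, j))"
    using assms i j by (intro index_mult_mat_sum[where m = "m * p" and p = "r * s"]) auto
  also have "\<dots> = (\<Sum>k<n. \<Sum>l<q. (A $$ (i div p, k) * B $$ (i mod p, l))
      * (C $$ (k, j div s) * D $$ (l, j mod s)))"
    using assms i j
    by (auto simp: sum_lessThan_times mult_add_less index_tensor_mat[of A m n B p q]
        index_tensor_mat[of C n r D q s] intro!: sum.cong)
  also have "\<dots> = (\<Sum>k<n. A $$ (i div p, k) * C $$ (k, j div s))
      * (\<Sum>l<q. B $$ (i mod p, l) * D $$ (l, j mod s))"
    by (simp add: sum_product mult_ac)
  also have "\<dots> = tensor_mat (A * C) (B * D) $$ (i, j)"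
    using assms i j
    by (simp add: index_tensor_mat[of "A * C" m r "B * D" p s] div_mod_less
        index_mult_mat_sum[of A m n C r] index_mult_mat_sum[of B p q D s] del: index_mult_mat)
  finally show "(tensor_mat A B * tensor_mat C D) $$ (i, j) = tensor_mat (A * C) (B * D) $$ (i, j)" .
qed (use assms in auto)

lemma mat_adjoint_tensor: "mat_adjoint (tensor_mat A B) = tensor_mat (mat_adjoint A) (mat_adjoint B)"
  by (rule eq_matI)
    (auto simp: index_tensor_mat[of A "dim_row A" "dim_col A" B "dim_row B" "dim_col B"]
      index_tensor_mat[of "mat_adjoint A" "dim_col A" "dim_row A" "mat_adjoint B" "dim_col B" "dim_row B"]
      div_mod_less)

lemma tensor_mat_one: "tensor_mat (1\<^sub>m m) (1\<^sub>m n) = 1\<^sub>m (m * n)"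
proof (rule eq_matI)
  fix i j assume "i < dim_row (1\<^sub>m (m * n) :: complex mat)" "j < dim_col (1\<^sub>m (m * n) :: complex mat)"
  then have ij: "i < m * n" "j < m * n" by auto
  have "i = j \<longleftrightarrow> i div n = j div n \<and> i mod n = j mod n"
    by (metis div_mult_mod_eq)
  then show "tensor_mat (1\<^sub>m m) (1\<^sub>m n) $$ (i, j) = 1\<^sub>m (m * n) $$ (i, j)"
    using ij by (auto simp: index_tensor_mat[of _ m m _ n n] div_mod_less)
qed auto

lemma tensor_mat_smult:
  "tensor_mat (a \<cdot>\<^sub>m A) (b \<cdot>\<^sub>m B) = (a * b) \<cdot>\<^sub>m tensor_mat A B"
  by (rule eq_matI)
    (auto simp: index_tensor_mat[of _ "dim_row A" "dim_col A" _ "dim_row B" "dim_col B"] div_mod_less)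

lemma unitary_mat_tensor:
  assumes "unitary_mat m V" "unitary_mat n W"
  shows "unitary_mat (m * n) (tensor_mat V W)"
  using unitary_matD[OF assms(1)] unitary_matD[OF assms(2)]
  by (simp add: unitary_mat_def mat_adjoint_tensor tensor_mat_mult[of _ m m _ n n _ m _ n] tensor_mat_one)

subsection \<open>Bipartite vectors as matrices\<close>

text \<open>Row-major order, in agreement with the index convention of \<open>tensor_vec\<close>:
  the row is Alice's label and the column is Bob's.\<close>

definition vec_of_mat :: "complex mat \<Rightarrow> complex vec" where
  "vec_of_mat X = vec (dim_row X * dim_col X) (\<lambda>i. X $$ (i div dim_col X, i mod dim_col X))"

lemma dim_vec_of_mat [simp]: "dim_vec (vec_of_mat X) = dim_row X * dim_col X"
  by (simp add: vec_of_mat_def)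

lemma index_vec_of_mat:
  "X \<in> carrier_mat m n \<Longrightarrow> i < m * n \<Longrightarrow> vec_of_mat X $ i = X $$ (i div n, i mod n)"
  by (auto simp: vec_of_mat_def)

text \<open>\<open>A\<close> contracts with the row index of \<open>X\<close> and \<open>B\<close>
  with its column index; the latter is multiplication from the right by the transpose, without
  conjugation.\<close>

lemma tensor_mat_mult_vec_of_mat:
  assumes "A \<in> carrier_mat m n" "B \<in> carrier_mat p q" "X \<in> carrier_mat n q"
  shows "tensor_mat A B *\<^sub>v vec_of_mat X = vec_of_mat (A * X * B\<^sup>T)"
proof (rule eq_vecI)
  fix i assume "i < dim_vec (vec_of_mat (A * X * B\<^sup>T))"
  then have i: "i < m * p" using assms by auto
  have "(tensor_mat A B *\<^sub>v vec_of_mat X) $ i = (\<Sum>k<n * q. tensor_mat A B $$ (i, k) * vec_of_mat X $ k)"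
    using assms i by (auto simp: scalar_prod_def atLeast0LessThan)
  also have "\<dots> = (\<Sum>k<n. \<Sum>l<q. (A $$ (i div p, k) * B $$ (i mod p, l)) * X $$ (k, l))"
    using assms i
    by (auto simp: sum_lessThan_times mult_add_less index_tensor_mat[of A m n B p q]
        index_vec_of_mat[of X n q] intro!: sum.cong)
  also have "\<dots> = (\<Sum>l<q. (\<Sum>k<n. A $$ (i div p, k) * X $$ (k, l)) * B $$ (i mod p, l))"
    by (subst sum.swap) (simp add: sum_distrib_left sum_distrib_right mult_ac)
  also have "\<dots> = (\<Sum>l<q. (A * X) $$ (i div p, l) * B\<^sup>T $$ (l, i mod p))"
    using assms i by (intro sum.cong refl)
      (auto simp: index_mult_mat_sum[of A m n X q] div_mod_less simp del: index_mult_mat)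
  also have "\<dots> = (A * X * B\<^sup>T) $$ (i div p, i mod p)"
    using assms i by (subst index_mult_mat_sum[of "A * X" m q _ p]) (auto simp: div_mod_less)
  also have "\<dots> = vec_of_mat (A * X * B\<^sup>T) $ i"
    using assms i by (subst index_vec_of_mat[of _ m p]) auto
  finally show "(tensor_mat A B *\<^sub>v vec_of_mat X) $ i = vec_of_mat (A * X * B\<^sup>T) $ i" .
qed (use assms in auto)

text \<open>Reduces the effect of a Kraus operator on a pure state to its action on the
  vector.\<close>

lemma ketbra_mult_vec:
  assumes "A \<in> carrier_mat m n" "v \<in> carrier_vec n"
  shows "A * ketbra v v * mat_adjoint A = ketbra (A *\<^sub>v v) (A *\<^sub>v v)"
proof (rule eq_matI)
  have K: "ketbra v v \<in> carrier_mat n n" using assms by (simp add: ketbra_def)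
  fix i j assume "i < dim_row (ketbra (A *\<^sub>v v) (A *\<^sub>v v))" "j < dim_col (ketbra (A *\<^sub>v v) (A *\<^sub>v v))"
  then have ij: "i < m" "j < m" using assms by (auto simp: ketbra_def)
  have "(A * ketbra v v * mat_adjoint A) $$ (i, j)
      = (\<Sum>l<n. (\<Sum>k<n. A $$ (i, k) * (v $ k * cnj (v $ l))) * cnj (A $$ (j, l)))"
    using assms ij K
    by (subst index_mult_mat_sum[of _ m n _ m])
      (auto simp: index_mult_mat_sum[of A m n _ n] ketbra_def simp del: index_mult_mat intro!: sum.cong)
  also have "\<dots> = (\<Sum>k<n. A $$ (i, k) * v $ k) * cnj (\<Sum>l<n. A $$ (j, l) * v $ l)"
    by (simp add: sum_product sum_distrib_left sum_distrib_right mult_ac)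
  also have "\<dots> = ketbra (A *\<^sub>v v) (A *\<^sub>v v) $$ (i, j)"
    using assms ij by (auto simp: ketbra_def scalar_prod_def atLeast0LessThan)
  finally show "(A * ketbra v v * mat_adjoint A) $$ (i, j) = ketbra (A *\<^sub>v v) (A *\<^sub>v v) $$ (i, j)" .
qed (use assms in \<open>auto simp: ketbra_def\<close>)

section \<open>Regrouping the four subsystems along the cut between Alice and Bob\<close>

text \<open>If \<open>i\<close> has the base-\<open>D\<close> digits a, c, b, d, most significant
  first, its image has the digits a, b, c, d. The high pair then labels H1 and H2, the low pair H3
  and H4.\<close>

lemma swap_middle_digits:
  assumes "i < D ^ 4"
  shows "swap_middle D i < D ^ 4"
    "swap_middle D i div (D * D) = (i div (D * D)) div D * D + (i mod (D * D)) div D"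
    "swap_middle D i mod (D * D) = (i div (D * D)) mod D * D + (i mod (D * D)) mod D"
proof -
  have D: "D > 0" using assms by (cases D) auto
  define a where "a = i div D ^ 3"
  define b where "b = (i div D) mod D"
  define c where "c = (i div D ^ 2) mod D"
  define d where "d = i mod D"
  have "D ^ 4 = D * D ^ 3" by (simp add: eval_nat_numeral)
  then have a: "a < D" using assms unfolding a_def
    by (metis less_mult_imp_div_less)
  have bcd: "b < D" "c < D" "d < D" using D by (auto simp: b_def c_def d_def)
  have s: "swap_middle D i = (a * D + b) * (D * D) + (c * D + d)"
    unfolding swap_middle_def a_def b_def c_def d_def by (simp add: algebra_simps)
  have cd: "c * D + d < D * D" using bcd by (simp add: mult_add_less)
  have ab: "a * D + b < D * D" using a bcd by (simp add: mult_add_less)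
  have "swap_middle D i < (D * D) * (D * D)" unfolding s using ab cd by (rule mult_add_less)
  then show "swap_middle D i < D ^ 4" by (simp add: eval_nat_numeral mult_ac)
  have "swap_middle D i div (D * D) = a * D + b" unfolding s using cd D by simp
  also have "a = (i div (D * D)) div D" by (simp add: a_def div_mult2_eq[symmetric] eval_nat_numeral mult_ac)
  also have "b = (i mod (D * D)) div D" unfolding b_def
    using D by (simp add: mod_mult2_eq)
  finally show "swap_middle D i div (D * D) = (i div (D * D)) div D * D + (i mod (D * D)) div D" .
  have "swap_middle D i mod (D * D) = c * D + d" unfolding s using cd D by simp
  also have "c = (i div (D * D)) mod D" by (simp add: c_def power2_eq_square)
  also have "d = (i mod (D * D)) mod D" by (simp add: d_def mod_mult2_eq)
  finally show "swap_middle D i mod (D * D) = (i div (D * D)) mod D * D + (i mod (D * D)) mod D" .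
qed

text \<open>Rows of \<open>X\<close> and \<open>Y\<close> belong to H1 and H3, columns to H2 and H4.
  The row index of the Kronecker product thus combines Alice's two labels and its column index
  Bob's, which is the order after regrouping.\<close>

lemma regroup_product_state:
  assumes "X \<in> carrier_mat D D" "Y \<in> carrier_mat D D"
  shows "regroup D (tensor_mat (ketbra (vec_of_mat X) (vec_of_mat X)) (ketbra (vec_of_mat Y) (vec_of_mat Y)))
      = ketbra (vec_of_mat (tensor_mat X Y)) (vec_of_mat (tensor_mat X Y))"
proof (rule eq_matI)
  let ?K = "\<lambda>X. ketbra (vec_of_mat X) (vec_of_mat X)"
  have D4: "D ^ 4 = D * D * (D * D)" by (simp add: eval_nat_numeral mult_ac)
  have K: "?K X \<in> carrier_mat (D * D) (D * D)" "?K Y \<in> carrier_mat (D * D) (D * D)"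
    using assms by (auto simp: ketbra_def)
  \<comment> \<open>The claim for amplitudes. It is applied once to the row index and once,
    conjugated, to the column index of the rank-one operators.\<close>
  have v: "vec_of_mat X $ (swap_middle D i div (D * D)) * vec_of_mat Y $ (swap_middle D i mod (D * D))
      = vec_of_mat (tensor_mat X Y) $ i" if "i < D ^ 4" for i
  proof -
    have i: "i div (D * D) < D * D" "i mod (D * D) < D * D" using that unfolding D4
      by (simp_all add: div_mod_less)
    define a b c d where "a = i div (D * D) div D" and "b = i mod (D * D) div D"
      and "c = i div (D * D) mod D" and "d = i mod (D * D) mod D"
    then have abcd: "a < D" "b < D" "c < D" "d < D" using i by (simp_all add: div_mod_less)
    have "vec_of_mat (tensor_mat X Y) $ i = X $$ (a, b) * Y $$ (c, d)"
      using assms i that unfolding a_def b_def c_def d_def D4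
      by (simp add: index_vec_of_mat[of _ "D * D" "D * D"] index_tensor_mat[of _ D D _ D D])
    moreover have "vec_of_mat X $ (a * D + b) = X $$ (a, b)" "vec_of_mat Y $ (c * D + d) = Y $$ (c, d)"
      using assms abcd by (simp_all add: index_vec_of_mat[of _ D D] mult_add_less)
    ultimately show ?thesis
      using swap_middle_digits(2,3)[OF that] by (simp add: a_def b_def c_def d_def)
  qed
  fix i j
  assume "i < dim_row (?K (tensor_mat X Y))" "j < dim_col (?K (tensor_mat X Y))"
  then have ij: "i < D ^ 4" "j < D ^ 4" using assms by (auto simp: ketbra_def D4)
  have s: "swap_middle D i div (D * D) < D * D" "swap_middle D i mod (D * D) < D * D"
     "swap_middle D j div (D * D) < D * D" "swap_middle D j mod (D * D) < D * D"
    using swap_middle_digits(1)[OF ij(1)] swap_middle_digits(1)[OF ij(2)] unfolding D4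
    by (simp_all add: div_mod_less)
  have "regroup D (tensor_mat (?K X) (?K Y)) $$ (i, j)
     = (vec_of_mat X $ (swap_middle D i div (D * D)) * vec_of_mat Y $ (swap_middle D i mod (D * D)))
      * cnj (vec_of_mat X $ (swap_middle D j div (D * D)) * vec_of_mat Y $ (swap_middle D j mod (D * D)))"
    using assms ij s swap_middle_digits(1)[OF ij(1)] swap_middle_digits(1)[OF ij(2)]
    by (simp add: regroup_def index_tensor_mat[OF K] D4) (simp add: ketbra_def)
  also have "\<dots> = ?K (tensor_mat X Y) $$ (i, j)"
    using assms ij by (simp add: v) (simp add: ketbra_def D4)
  finally show "regroup D (tensor_mat (?K X) (?K Y)) $$ (i, j) = ?K (tensor_mat X Y) $$ (i, j)" .
qed (use assms in \<open>auto simp: regroup_def ketbra_def eval_nat_numeral\<close>)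

subsection \<open>Maximally entangled states\<close>

text \<open>Pairing a vanishing linear combination with one of its vectors isolates the coefficient
  of that vector, so the family is independent; its size equals the dimension. This supplies the
  basis clause for families read off from unitary matrices.\<close>

lemma orthonormal_basis_vectors:
  assumes carr: "\<And>i. i < D \<Longrightarrow> e i \<in> carrier_vec D"
    and orth: "\<And>i j. i < D \<Longrightarrow> j < D \<Longrightarrow> e i \<bullet>c e j = (if i = j then 1 else 0)"
  shows "vectorspace.basis class_ring (module_vec TYPE(complex) D) (e ` {..<D})"
proof -
  interpret vec_space "TYPE(complex)" D .
  let ?S = "e ` {..<D}"
  have S: "?S \<subseteq> carrier_vec D" using carr by auto
  \<comment> \<open>Needed for the cardinality of the set, and to decide inner products by equality
    of vectors instead of indices.\<close>
  have inj: "inj_on e {..<D}"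
  proof (rule inj_onI)
    fix i j assume "i \<in> {..<D}" "j \<in> {..<D}" "e i = e j"
    then show "i = j" using orth[of i i] orth[of i j] by (auto split: if_splits)
  qed
  have "lin_indpt ?S"
  proof
    assume "lin_dep ?S"
    then obtain A a v where A: "finite A" "A \<subseteq> ?S" "lincomb a A = 0\<^sub>v D" "v \<in> A" "a v \<noteq> 0"
      unfolding lin_dep_def by auto
    then have Ac: "A \<subseteq> carrier_vec D" using S by auto
    have dot: "(\<Sum>i<D. x $ i * cnj (v $ i)) = (if x = v then 1 else 0)" if "x \<in> A" for x
    proof -
      have "x \<in> ?S" "v \<in> ?S" using A(2,4) that by auto
      then obtain i j where ij: "i < D" "j < D" "x = e i" "v = e j" by auto
      have "(\<Sum>i<D. x $ i * cnj (v $ i)) = x \<bullet>c v"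
        using carr[OF ij(2)] by (simp add: scalar_prod_def atLeast0LessThan ij(4))
      then show ?thesis using ij orth[of i j] inj by (auto simp: inj_on_def)
    qed
    have "0 = (\<Sum>i<D. lincomb a A $ i * cnj (v $ i))" using A by simp
    also have "\<dots> = (\<Sum>i<D. \<Sum>x\<in>A. a x * (x $ i * cnj (v $ i)))"
      using Ac by (intro sum.cong refl) (simp add: lincomb_index sum_distrib_left sum_distrib_right mult_ac)
    also have "\<dots> = (\<Sum>x\<in>A. a x * (\<Sum>i<D. x $ i * cnj (v $ i)))"
      by (subst sum.swap) (simp add: sum_distrib_left)
    also have "\<dots> = (\<Sum>x\<in>A. if x = v then a x else 0)"
      by (intro sum.cong refl) (simp add: dot)
    also have "\<dots> = a v" using A by (simp add: sum.delta)
    finally show False using A by simp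
  qed
  then show ?thesis
    using S inj by (intro dim_li_is_basis) (auto simp: dim_is_n card_image)
qed

text \<open>With the vectors as columns of a matrix, the adjoint times the matrix is their Gram
  matrix.\<close>

lemma orthonormal_basis_iff:
  "orthonormal_basis D e \<longleftrightarrow>
    (\<forall>i<D. e i \<in> carrier_vec D) \<and> unitary_mat D (mat D D (\<lambda>(i, k). e k $ i))"
proof -
  let ?E = "mat D D (\<lambda>(i, k). e k $ i)"
  \<comment> \<open>The indices are exchanged because \<open>\<bullet>c\<close> conjugates its
    second argument.\<close>
  have entry: "(mat_adjoint ?E * ?E) $$ (j, i) = e i \<bullet>c e j"
    if "\<forall>i<D. e i \<in> carrier_vec D" "i < D" "j < D" for i j
    using that
    by (subst index_mult_mat_sum[of _ D D _ D])
      (auto simp: scalar_prod_def atLeast0LessThan mult.commute intro!: sum.cong)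
  show ?thesis
  proof
    assume e: "orthonormal_basis D e"
    then have "mat_adjoint ?E * ?E = 1\<^sub>m D"
      by (intro eq_matI) (auto simp: orthonormal_basis_def entry simp del: index_mult_mat(1))
    then show "(\<forall>i<D. e i \<in> carrier_vec D) \<and> unitary_mat D ?E"
      using e by (simp add: orthonormal_basis_def unitary_mat_def)
  next
    assume e: "(\<forall>i<D. e i \<in> carrier_vec D) \<and> unitary_mat D ?E"
    then have "e i \<bullet>c e j = (if i = j then 1 else 0)" if "i < D" "j < D" for i j
      using entry[of i j] that by (auto simp: unitary_mat_def)
    then show "orthonormal_basis D e"
      using e orthonormal_basis_vectors[of D e] by (auto simp: orthonormal_basis_def)
  qed
qed

lemma tensor_vec_carrier: "v \<in> carrier_vec m \<Longrightarrow> w \<in> carrier_vec n \<Longrightarrow> tensor_vec v w \<in> carrier_vec (m * n)"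
  by (auto simp: tensor_vec_def)

lemma index_tensor_vec:
  "v \<in> carrier_vec m \<Longrightarrow> w \<in> carrier_vec n \<Longrightarrow> i < m * n \<Longrightarrow>
    tensor_vec v w $ i = v $ (i div n) * w $ (i mod n)"
  by (auto simp: tensor_vec_def)

lemma vec_of_mat_smult_sum_tensor:
  assumes "\<And>k. k < D \<Longrightarrow> e k \<in> carrier_vec D" "\<And>k. k < D \<Longrightarrow> f k \<in> carrier_vec D"
    and "W \<in> carrier_mat D D"
    and "\<And>i j. i < D \<Longrightarrow> j < D \<Longrightarrow> W $$ (i, j) = (\<Sum>k<D. e k $ i * f k $ j)"
  shows "c \<cdot>\<^sub>v finsum_vec TYPE(complex) (D * D) (\<lambda>k. tensor_vec (e k) (f k)) {..<D} = vec_of_mat (c \<cdot>\<^sub>m W)"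
proof -
  have T: "(\<lambda>k. tensor_vec (e k) (f k)) \<in> {..<D} \<rightarrow> carrier_vec (D * D)"
    using assms(1,2) by (intro Pi_I tensor_vec_carrier) simp_all
  have dim: "dim_vec (finsum_vec TYPE(complex) (D * D) (\<lambda>k. tensor_vec (e k) (f k)) {..<D}) = D * D"
    using finsum_vec_closed[OF T] by auto
  show ?thesis
  proof (rule eq_vecI)
    fix i assume "i < dim_vec (vec_of_mat (c \<cdot>\<^sub>m W))"
    then have i: "i < D * D" using assms by auto
    have "finsum_vec TYPE(complex) (D * D) (\<lambda>k. tensor_vec (e k) (f k)) {..<D} $ i
        = (\<Sum>k<D. tensor_vec (e k) (f k) $ i)"
      using i T by (intro index_finsum_vec) auto
    also have "\<dots> = (\<Sum>k<D. e k $ (i div D) * f k $ (i mod D))"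
      using assms(1,2) i by (intro sum.cong refl index_tensor_vec[of _ D]) simp_all
    finally show "(c \<cdot>\<^sub>v finsum_vec TYPE(complex) (D * D) (\<lambda>k. tensor_vec (e k) (f k)) {..<D}) $ i
       = vec_of_mat (c \<cdot>\<^sub>m W) $ i"
      using assms i dim
      by (auto simp: index_vec_of_mat[of _ D D] div_mod_less)
  qed (use assms dim in auto)
qed

text \<open>If \<open>E\<close> and \<open>F\<close> have the two bases as columns, the sum of the
  product vectors has the coefficient matrix \<open>E * F\<^sup>T\<close>, a product of
  unitaries.\<close>

lemma maximally_entangled_iff:
  "maximally_entangled D \<psi> \<longleftrightarrow>
    (\<exists>W. unitary_mat D W \<and> \<psi> = vec_of_mat (complex_of_real (1 / sqrt (real D)) \<cdot>\<^sub>m W))"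
    (is "_ \<longleftrightarrow> (\<exists>W. _ \<and> \<psi> = vec_of_mat (?c \<cdot>\<^sub>m W))")
proof
  assume "maximally_entangled D \<psi>"
  then obtain e f where ef: "orthonormal_basis D e" "orthonormal_basis D f"
    and \<psi>: "\<psi> = ?c \<cdot>\<^sub>v finsum_vec TYPE(complex) (D * D) (\<lambda>k. tensor_vec (e k) (f k)) {..<D}"
    unfolding maximally_entangled_def by blast
  let ?M = "\<lambda>e. mat D D (\<lambda>(i, k). e k $ i) :: complex mat"
  let ?W = "?M e * (?M f)\<^sup>T"
  have "unitary_mat D ?W"
    using ef by (intro unitary_mat_mult unitary_mat_transpose) (simp_all add: orthonormal_basis_iff)
  moreover have "\<psi> = vec_of_mat (?c \<cdot>\<^sub>m ?W)"
    unfolding \<psi> using ef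
    by (intro vec_of_mat_smult_sum_tensor)
      (auto simp: orthonormal_basis_def index_mult_mat_sum[of _ D D _ D] simp del: index_mult_mat(1))
  ultimately show "\<exists>W. unitary_mat D W \<and> \<psi> = vec_of_mat (?c \<cdot>\<^sub>m W)" by blast
next
  assume "\<exists>W. unitary_mat D W \<and> \<psi> = vec_of_mat (?c \<cdot>\<^sub>m W)"
  then obtain W where W: "unitary_mat D W" and \<psi>: "\<psi> = vec_of_mat (?c \<cdot>\<^sub>m W)" by blast
  note Wc = unitary_matD(1)[OF W]
  \<comment> \<open>For the converse the standard basis is taken on the first factor and the rows of
    \<open>W\<close> on the second.\<close>
  have "mat D D (\<lambda>(i, k). unit_vec D k $ i) = (1\<^sub>m D :: complex mat)"
    by (rule eq_matI) auto
  then have e: "orthonormal_basis D (unit_vec D)"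
    by (simp add: orthonormal_basis_iff unitary_mat_one)
  have "mat D D (\<lambda>(i, k). row W k $ i) = W\<^sup>T"
    using Wc by (intro eq_matI) auto
  then have f: "orthonormal_basis D (row W)"
    using W Wc by (auto simp: orthonormal_basis_iff unitary_mat_transpose)
  have "\<psi> = ?c \<cdot>\<^sub>v finsum_vec TYPE(complex) (D * D) (\<lambda>k. tensor_vec (unit_vec D k) (row W k)) {..<D}"
    unfolding \<psi> using Wc
    by (intro vec_of_mat_smult_sum_tensor[symmetric])
      (auto simp: if_distrib[of "\<lambda>x. x * _"] sum.delta' cong: if_cong)
  then show "maximally_entangled D \<psi>"
    unfolding maximally_entangled_def using e f by blast
qed

text \<open>The squared norm is \<open>1 / D\<close> times the sum of the squared moduli of the
  entries of \<open>W\<close>, and each of its \<open>D\<close> rows contributes 1. This makes such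
  a state admissible as a blank.\<close>

lemma maximally_entangled_normalized:
  assumes "maximally_entangled D \<psi>" "D \<ge> 1"
  shows "\<psi> \<bullet>c \<psi> = 1"
proof -
  let ?c = "complex_of_real (1 / sqrt (real D))"
  obtain W where W: "unitary_mat D W" and \<psi>: "\<psi> = vec_of_mat (?c \<cdot>\<^sub>m W)"
    using assms by (auto simp: maximally_entangled_iff)
  note Wc = unitary_matD(1)[OF W]
  have "(\<Sum>j<D. W $$ (i, j) * cnj (W $$ (i, j))) = (W * mat_adjoint W) $$ (i, i)" if "i < D" for i
    using that Wc by (subst index_mult_mat_sum[of _ D D _ D]) auto
  then have row: "(\<Sum>j<D. W $$ (i, j) * cnj (W $$ (i, j))) = 1" if "i < D" for i
    using that unitary_matD(3)[OF W] by simp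
  have "\<psi> \<bullet>c \<psi> = (\<Sum>k<D * D. \<psi> $ k * cnj (\<psi> $ k))"
    using Wc by (auto simp: \<psi> scalar_prod_def atLeast0LessThan)
  also have "\<dots> = (\<Sum>i<D. \<Sum>j<D. (?c * ?c) * (W $$ (i, j) * cnj (W $$ (i, j))))"
    using Wc unfolding \<psi> sum_lessThan_times
    by (intro sum.cong refl) (simp add: index_vec_of_mat[of _ D D] mult_add_less mult_ac)
  also have "\<dots> = (?c * ?c) * of_nat D"
    unfolding sum_distrib_left[symmetric] by (simp add: row)
  also have "?c * ?c = 1 / of_nat D"
    by (simp flip: of_real_mult)
  finally show ?thesis using assms(2) by simp
qed

subsection \<open>Local unitary protocols\<close>

lemma msum_one: "X \<in> carrier_mat r c \<Longrightarrow> msum r c (\<lambda>k. X) 1 = X"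
  by (rule eq_matI) (auto simp: msum_def)

text \<open>A unitary is a measurement with a single outcome: completeness is unitarity, and nothing
  needs to be communicated. One round for each party suffices.\<close>

lemma locc_local_unitaries:
  assumes "unitary_mat m A" "unitary_mat n B"
  obtains \<Lambda> where "locc m n m n \<Lambda>"
    and "\<And>X. X \<in> carrier_mat m n \<Longrightarrow>
      \<Lambda> (ketbra (vec_of_mat X) (vec_of_mat X)) = ketbra (vec_of_mat (A * X * B\<^sup>T)) (vec_of_mat (A * X * B\<^sup>T))"
proof -
  note A = unitary_matD[OF assms(1)] and B = unitary_matD[OF assms(2)]
  \<comment> \<open>Bob's round is built first because it is the continuation inside Alice's round;
    the final \<open>1\<close> is the number of outcomes.\<close>
  define \<Lambda>B where "\<Lambda>B = (\<lambda>\<rho>. msum (m * n) (m * n)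
    (\<lambda>k::nat. tensor_mat (1\<^sub>m m) B * \<rho> * mat_adjoint (tensor_mat (1\<^sub>m m) B)) 1)"
  define \<Lambda> where "\<Lambda> = (\<lambda>\<rho>. msum (m * n) (m * n)
    (\<lambda>k::nat. \<Lambda>B (tensor_mat A (1\<^sub>m n) * \<rho> * mat_adjoint (tensor_mat A (1\<^sub>m n)))) 1)"
  have "locc m n m n \<Lambda>B"
    unfolding \<Lambda>B_def
    using B by (intro locc.bob[where K = "\<lambda>k. B" and \<Lambda> = "\<lambda>k \<rho>. \<rho>" and d = "\<lambda>k. n"])
      (simp_all add: msum_one locc.stop del: One_nat_def)
  then have "locc m n m n \<Lambda>"
    unfolding \<Lambda>_def
    using A by (intro locc.alice[where K = "\<lambda>k. A" and \<Lambda> = "\<lambda>k. \<Lambda>B" and d = "\<lambda>k. m"])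
      (simp_all add: msum_one del: One_nat_def)
  moreover have "\<Lambda> (ketbra (vec_of_mat X) (vec_of_mat X))
      = ketbra (vec_of_mat (A * X * B\<^sup>T)) (vec_of_mat (A * X * B\<^sup>T))"
    if X: "X \<in> carrier_mat m n" for X
  proof -
    have carr: "vec_of_mat Y \<in> carrier_vec (m * n)"
      "ketbra (vec_of_mat Y) (vec_of_mat Y) \<in> carrier_mat (m * n) (m * n)"
      if "Y \<in> carrier_mat m n" for Y
      using that by (auto simp: ketbra_def carrier_dim_vec)
    have AX: "A * X \<in> carrier_mat m n" and AXB: "A * X * B\<^sup>T \<in> carrier_mat m n"
      using A B X by auto
    have "\<Lambda>B (ketbra (vec_of_mat (A * X)) (vec_of_mat (A * X)))
        = ketbra (vec_of_mat (A * X * B\<^sup>T)) (vec_of_mat (A * X * B\<^sup>T))"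
      unfolding \<Lambda>B_def using A B AX carr[OF AXB] carr[OF AX]
      by (simp add: ketbra_mult_vec[of _ "m * n" "m * n"] tensor_mat_mult_vec_of_mat[of _ m m _ n n] msum_one
          del: One_nat_def)
    moreover have "tensor_mat A (1\<^sub>m n) * ketbra (vec_of_mat X) (vec_of_mat X) * mat_adjoint (tensor_mat A (1\<^sub>m n))
        = ketbra (vec_of_mat (A * X)) (vec_of_mat (A * X))"
      using A X AX carr[OF X]
      by (simp add: ketbra_mult_vec[of _ "m * n" "m * n"] tensor_mat_mult_vec_of_mat[of _ m m _ n n])
    ultimately show ?thesis
      unfolding \<Lambda>_def using carr[OF AXB] by (simp add: msum_one del: One_nat_def)
  qed
  ultimately show ?thesis using that by blast
qed

subsection \<open>Diagonal phases and the controlled shift\<close>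

definition diag_fun :: "nat \<Rightarrow> (nat \<Rightarrow> complex) \<Rightarrow> complex mat" where
  "diag_fun n d = mat n n (\<lambda>(i, j). if i = j then d i else 0)"

lemma diag_fun_carrier [simp]: "diag_fun n d \<in> carrier_mat n n"
  by (simp add: diag_fun_def)

lemma diag_fun_one: "1\<^sub>m n = diag_fun n (\<lambda>_. 1)"
  by (rule eq_matI) (auto simp: diag_fun_def)

lemma index_diag_fun_mult:
  assumes "Q \<in> carrier_mat n m" "i < n" "j < m"
  shows "(diag_fun n d * Q) $$ (i, j) = d i * Q $$ (i, j)"
  using assms
  by (subst index_mult_mat_sum[of _ n n _ m])
    (auto simp: diag_fun_def if_distrib[of "\<lambda>x. x * _"] cong: if_cong)

lemma index_mult_diag_fun:
  assumes "Q \<in> carrier_mat m n" "i < m" "j < n"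
  shows "(Q * diag_fun n d) $$ (i, j) = Q $$ (i, j) * d j"
  using assms
  by (subst index_mult_mat_sum[of _ m n _ n])
    (auto simp: diag_fun_def if_distrib[of "\<lambda>x. _ * x"] cong: if_cong)

lemma unitary_diag_fun:
  assumes "\<And>k. k < n \<Longrightarrow> norm (d k) = 1"
  shows "unitary_mat n (diag_fun n d)"
proof -
  have "cnj (d k) * d k = 1" if "k < n" for k
    using assms[OF that] complex_norm_square[of "d k"] by (simp add: mult.commute)
  then have "mat_adjoint (diag_fun n d) * diag_fun n d = 1\<^sub>m n"
    by (intro eq_matI) (simp_all add: index_mult_diag_fun[of _ n] del: index_mult_mat(1), simp_all add: diag_fun_def)
  then show ?thesis by (simp add: unitary_mat_def)
qed

lemma tensor_diag_fun:
  "tensor_mat (diag_fun m a) (diag_fun n b) = diag_fun (m * n) (\<lambda>i. a (i div n) * b (i mod n))"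
proof (rule eq_matI)
  fix i j
  assume "i < dim_row (diag_fun (m * n) (\<lambda>i. a (i div n) * b (i mod n)))"
    "j < dim_col (diag_fun (m * n) (\<lambda>i. a (i div n) * b (i mod n)))"
  then have ij: "i < m * n" "j < m * n" by (auto simp: diag_fun_def)
  have "i = j \<longleftrightarrow> i div n = j div n \<and> i mod n = j mod n"
    by (metis div_mult_mod_eq)
  then show "tensor_mat (diag_fun m a) (diag_fun n b) $$ (i, j)
      = diag_fun (m * n) (\<lambda>i. a (i div n) * b (i mod n)) $$ (i, j)"
    using ij by (auto simp: index_tensor_mat[of _ m m _ n n] diag_fun_def div_mod_less)
qed (auto simp: diag_fun_def)

text \<open>The column that holds the 1 of row \<open>r\<close>. Row (k, l) has it in column (k + l
  mod D, l), so the matrix sends |k>|l> to |k - l>|l>; describing it by rows avoids subtraction of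
  natural numbers.\<close>

definition shift_index :: "nat \<Rightarrow> nat \<Rightarrow> nat" where
  "shift_index D r = (r div D + r mod D) mod D * D + r mod D"

definition shift_mat :: "nat \<Rightarrow> complex mat" where
  "shift_mat D = mat (D * D) (D * D) (\<lambda>(r, c). if c = shift_index D r then 1 else 0)"

lemma shift_mat_carrier [simp]: "shift_mat D \<in> carrier_mat (D * D) (D * D)"
  by (simp add: shift_mat_def)

lemma shift_index:
  assumes "r < D * D"
  shows "shift_index D r < D * D"
    "shift_index D r div D = (r div D + r mod D) mod D"
    "shift_index D r mod D = r mod D"
proof -
  have D: "D > 0" using assms by (cases D) auto
  show "shift_index D r < D * D" unfolding shift_index_def using D by (intro mult_add_less) auto
  show "shift_index D r div D = (r div D + r mod D) mod D" "shift_index D r mod D = r mod D"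
    using D by (simp_all add: shift_index_def)
qed

text \<open>The low digit is preserved, and adding a fixed residue modulo \<open>D\<close> is
  injective on residues.\<close>

lemma shift_index_eq_iff:
  assumes "r < D * D" "c < D * D"
  shows "shift_index D r = shift_index D c \<longleftrightarrow> r = c"
proof
  assume eq: "shift_index D r = shift_index D c"
  have l: "r mod D = c mod D"
    using eq shift_index(3)[OF assms(1)] shift_index(3)[OF assms(2)] by simp
  have "(r div D + r mod D) mod D = (c div D + r mod D) mod D"
    using eq l shift_index(2)[OF assms(1)] shift_index(2)[OF assms(2)] by simp
  moreover have "r div D < D" "c div D < D" "r mod D < D"
    using assms by (simp_all add: div_mod_less)
  moreover have "(x + y) mod D = (if x + y < D then x + y else x + y - D)" if "x < D" "y < D" for x y
    using that by (auto simp: le_mod_geq)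
  ultimately have "r div D = c div D"
    by (simp split: if_splits)
  with l show "r = c" by (metis div_mult_mod_eq)
qed simp

lemma index_shift_mat_mult:
  assumes "Q \<in> carrier_mat (D * D) m" "r < D * D" "c < m"
  shows "(shift_mat D * Q) $$ (r, c) = Q $$ (shift_index D r, c)"
  using assms shift_index(1)[OF assms(2)]
  by (subst index_mult_mat_sum[of _ "D * D" "D * D" _ m])
    (auto simp: shift_mat_def if_distrib[of "\<lambda>x. x * _"] cong: if_cong)

text \<open>By injectivity of \<open>shift_index\<close> the rows are distinct standard unit
  vectors, so the product with the adjoint on the right is the identity; squareness gives the other
  order.\<close>

lemma unitary_shift_mat: "unitary_mat (D * D) (shift_mat D)"
proof -
  have "shift_mat D * mat_adjoint (shift_mat D) = 1\<^sub>m (D * D)"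
  proof (rule eq_matI)
    fix r c assume "r < dim_row (1\<^sub>m (D * D) :: complex mat)" "c < dim_col (1\<^sub>m (D * D) :: complex mat)"
    then have rc: "r < D * D" "c < D * D" by auto
    have "(shift_mat D * mat_adjoint (shift_mat D)) $$ (r, c) = mat_adjoint (shift_mat D) $$ (shift_index D r, c)"
      using rc by (intro index_shift_mat_mult[of _ D "D * D"]) simp_all
    also have "\<dots> = 1\<^sub>m (D * D) $$ (r, c)"
      using rc shift_index(1)[OF rc(1)] shift_index_eq_iff[OF rc]
      by (subst index_mat_adjoint) (auto simp: shift_mat_def)
    finally show "(shift_mat D * mat_adjoint (shift_mat D)) $$ (r, c) = 1\<^sub>m (D * D) $$ (r, c)" .
  qed (simp_all add: shift_mat_def)
  then have "mat_adjoint (shift_mat D) * shift_mat D = 1\<^sub>m (D * D)"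
    by (rule mat_mult_left_right_inverse[rotated 2]) simp_all
  then show ?thesis by (simp add: unitary_mat_def)
qed

text \<open>The phases are characters of the cyclic group of order \<open>D\<close>, so shifting the first label
  by the second copies them onto the second register.\<close>

lemma shift_mat_copies_phases:
  assumes "\<And>a b. a < D \<Longrightarrow> b < D \<Longrightarrow> d ((a + b) mod D) = d a * d b"
  shows "shift_mat D * tensor_mat (diag_fun D d) (1\<^sub>m D)
    = tensor_mat (diag_fun D d) (diag_fun D d) * shift_mat D"
  \<comment> \<open>With the identity written as a diagonal matrix, both sides are diagonal matrices
    times the same permutation, and only the column \<open>shift_index D r\<close> of row
    \<open>r\<close> can be nonzero.\<close>
  unfolding diag_fun_one tensor_diag_fun
proof (rule eq_matI)
  let ?T = "diag_fun (D * D) (\<lambda>i. d (i div D) * 1)"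
  let ?S = "diag_fun (D * D) (\<lambda>i. d (i div D) * d (i mod D))"
  fix r c assume "r < dim_row (?S * shift_mat D)" "c < dim_col (?S * shift_mat D)"
  then have rc: "r < D * D" "c < D * D" by (auto simp: diag_fun_def shift_mat_def)
  show "(shift_mat D * ?T) $$ (r, c) = (?S * shift_mat D) $$ (r, c)"
    using rc shift_index[OF rc(1)] assms[of "r div D" "r mod D"]
    by (auto simp: index_shift_mat_mult[of _ D "D * D"] index_diag_fun_mult[of _ _ "D * D"] div_mod_less
        simp del: index_mult_mat(1))
      (auto simp: diag_fun_def shift_mat_def)
qed (auto simp: diag_fun_def shift_mat_def)

section \<open>Change of basis and cancellation of unitaries\<close>

text \<open>Carries the relation between shift and phases from the standard basis to the given
  basis.\<close>

lemma conjugate_mult: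
  assumes "unitary_mat n V" "X \<in> carrier_mat n n" "Y \<in> carrier_mat n n"
  shows "(V * X * mat_adjoint V) * (V * Y * mat_adjoint V) = V * (X * Y) * mat_adjoint V"
proof -
  note V = unitary_matD[OF assms(1)]
  have "(V * X * mat_adjoint V) * (V * Y * mat_adjoint V)
      = V * X * (mat_adjoint V * V) * Y * mat_adjoint V"
    using V(1) assms(2,3) by (simp add: assoc_mult_mat[of _ n n _ n _ n] mult_carrier_mat[of _ n n])
  also have "\<dots> = V * (X * Y) * mat_adjoint V"
    unfolding V(2)
    using V(1) assms(2,3) by (simp add: assoc_mult_mat[of _ n n _ n _ n] mult_carrier_mat[of _ n n])
  finally show ?thesis .
qed

lemma tensor_conjugate:
  assumes "V \<in> carrier_mat n n" "X \<in> carrier_mat n n" "Y \<in> carrier_mat n n"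
  shows "tensor_mat (V * X * mat_adjoint V) (V * Y * mat_adjoint V)
    = tensor_mat V V * tensor_mat X Y * mat_adjoint (tensor_mat V V)"
  using assms
  by (simp add: mat_adjoint_tensor tensor_mat_mult[of _ n n _ n n _ n _ n] mult_carrier_mat[of _ n n])

text \<open>The last factor is chosen so that \<open>V\<close> times it equals
  \<open>A\<^sup>\<dagger> V\<close>. Then
  \<open>A T A\<^sup>\<dagger> = S A A\<^sup>\<dagger> = S\<close> remains in front of
  \<open>V\<close>.\<close>

lemma intertwiner_cancel:
  assumes "unitary_mat n A" "unitary_mat n V" "T \<in> carrier_mat n n" "S \<in> carrier_mat n n"
    and "A * T = S * A"
  shows "A * (T * V) * (mat_adjoint V * mat_adjoint A * V) = S * V"
proof -
  note A = unitary_matD[OF assms(1)] and V = unitary_matD[OF assms(2)]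
  note carr = A(1) V(1) assms(3,4) mat_adjoint_carrier[OF A(1)] mat_adjoint_carrier[OF V(1)]
  note assoc = assoc_mult_mat[of _ n n _ n _ n] mult_carrier_mat[of _ n n _ n]
  have "A * (T * V) * (mat_adjoint V * mat_adjoint A * V)
      = (A * T) * (V * mat_adjoint V) * mat_adjoint A * V"
    using carr by (simp add: assoc)
  also have "\<dots> = S * (A * mat_adjoint A) * V"
    unfolding assms(5) V(3) using carr by (simp add: assoc)
  also have "\<dots> = S * V"
    unfolding A(3) using carr by simp
  finally show ?thesis .
qed

lemma power_mod_of_power_eq_1:
  fixes z :: "'a::monoid_mult"
  assumes "z ^ D = 1"
  shows "z ^ (n mod D) = z ^ n"
proof -
  have "z ^ n = (z ^ D) ^ (n div D) * z ^ (n mod D)"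
    by (simp flip: power_mult power_add)
  then show ?thesis using assms by simp
qed

section \<open>Assembly of the copying protocol\<close>

text \<open>The first conjunct makes explicit that the copied states are maximally entangled: their
  coefficient matrices are \<open>U j * W\<close> up to the factor
  \<open>1 / sqrt D\<close>.\<close>

theorem theorem3:
  fixes D N :: nat and \<Psi>0 :: "complex vec" and e :: "nat \<Rightarrow> complex vec"
    and \<omega> :: complex and U :: "nat \<Rightarrow> complex mat" and \<Psi> :: "nat \<Rightarrow> complex vec"
  assumes "D \<ge> 1" and "N \<ge> 1"
    and "maximally_entangled D \<Psi>0"
    and "orthonormal_basis D e"
    and "\<omega> = exp (2 * complex_of_real pi * \<i> / of_nat D)"
    and "\<And>j. j < N \<Longrightarrow> U j = msum D D (\<lambda>k. \<omega> ^ (j * k) \<cdot>\<^sub>m ketbra (e k) (e k)) D"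
    and "\<And>j. j < N \<Longrightarrow> \<Psi> j = tensor_mat (U j) (1\<^sub>m D) *\<^sub>v \<Psi>0"
  shows "(\<forall>j<N. maximally_entangled D (\<Psi> j)) \<and> locally_copiable D N \<Psi>"
proof -
  let ?c = "complex_of_real (1 / sqrt (real D))"
  obtain W where W: "unitary_mat D W" and \<Psi>0: "\<Psi>0 = vec_of_mat (?c \<cdot>\<^sub>m W)"
    using assms(3) by (auto simp: maximally_entangled_iff)
  note Wc = unitary_matD(1)[OF W]
  define E where "E = mat D D (\<lambda>(i, k). e k $ i)"
  have E: "unitary_mat D E" and e: "\<And>k. k < D \<Longrightarrow> e k \<in> carrier_vec D"
    using assms(4) by (auto simp: orthonormal_basis_iff E_def)
  note Ec = unitary_matD(1)[OF E]
  define \<Delta> where "\<Delta> j = diag_fun D (\<lambda>k. \<omega> ^ (j * k))" for j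
  have \<Delta>c: "\<Delta> j \<in> carrier_mat D D" for j by (simp add: \<Delta>_def)

  \<comment> \<open>Diagonalization of \<open>U j\<close>: the columns of \<open>E\<close> are the
    basis vectors \<open>e k\<close>.\<close>
  have U: "U j = E * \<Delta> j * mat_adjoint E" if "j < N" for j
  proof (rule eq_matI)
    fix r c assume "r < dim_row (E * \<Delta> j * mat_adjoint E)" "c < dim_col (E * \<Delta> j * mat_adjoint E)"
    then have rc: "r < D" "c < D" using Ec by auto
    have "(E * \<Delta> j * mat_adjoint E) $$ (r, c) = (\<Sum>k<D. (E * \<Delta> j) $$ (r, k) * mat_adjoint E $$ (k, c))"
      using Ec \<Delta>c[of j] rc by (intro index_mult_mat_sum[of _ D D _ D]) auto
    also have "\<dots> = (\<Sum>k<D. \<omega> ^ (j * k) * (e k $ r * cnj (e k $ c)))"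
      using Ec rc
      by (intro sum.cong refl) (simp add: \<Delta>_def index_mult_diag_fun[of _ D] E_def del: index_mult_mat(1))
    also have "\<dots> = U j $$ (r, c)"
      unfolding assms(6)[OF that] msum_def using rc carrier_vecD[OF e]
      by (simp add: ketbra_def)
    finally show "U j $$ (r, c) = (E * \<Delta> j * mat_adjoint E) $$ (r, c)" ..
  qed (use that Ec in \<open>auto simp: assms(6) msum_def\<close>)

  \<comment> \<open>This makes exponents of \<open>\<omega>\<close> depend only on their residue
    modulo \<open>D\<close>, as the cyclic shift requires.\<close>
  have "\<omega> ^ D = exp (of_nat D * (2 * complex_of_real pi * \<i> / of_nat D))"
    unfolding assms(5) by (rule exp_of_nat_mult[symmetric])
  also have "\<dots> = 1"
    using assms(1) by (simp add: exp_two_pi_i)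
  finally have \<omega>D: "\<omega> ^ D = 1" .
  have norm_\<omega>: "norm \<omega> = 1"
    unfolding assms(5) by simp
  have "unitary_mat D (\<Delta> j)" for j
    unfolding \<Delta>_def by (rule unitary_diag_fun) (simp add: norm_power norm_\<omega>)
  then have Uu: "unitary_mat D (U j)" if "j < N" for j
    unfolding U[OF that] using E by (intro unitary_mat_mult unitary_mat_adjoint)

  have \<Psi>: "\<Psi> j = vec_of_mat (?c \<cdot>\<^sub>m (U j * W))" if "j < N" for j
    unfolding assms(7)[OF that] \<Psi>0
    using unitary_matD(1)[OF Uu[OF that]] Wc
    by (simp add: tensor_mat_mult_vec_of_mat[of _ D D _ D D] mult_smult_distrib[of _ D D _ D] mult_carrier_mat[of _ D D])
  have max: "maximally_entangled D (\<Psi> j)" if "j < N" for j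
    unfolding maximally_entangled_iff using \<Psi>[OF that] unitary_mat_mult[OF Uu[OF that] W] by blast

  define n where "n = D * D"
  define EE where "EE = tensor_mat E E"
  define WW where "WW = tensor_mat W W"
  \<comment> \<open>Alice's controlled shift, with both of her registers expressed in the basis
    \<open>e\<close>. Neither \<open>A\<close> nor \<open>C\<close> depends on \<open>j\<close>, so
    one protocol serves all states.\<close>
  define A where "A = EE * shift_mat D * mat_adjoint EE"
  \<comment> \<open>The right factor acting on coefficient matrices; Bob's unitary is its
    transpose.\<close>
  define C where "C = mat_adjoint WW * mat_adjoint A * WW"
  have EE: "unitary_mat n EE" and WW: "unitary_mat n WW"
    using E W by (simp_all add: n_def EE_def WW_def unitary_mat_tensor)
  have A: "unitary_mat n A"
    unfolding A_def using EE by (intro unitary_mat_mult unitary_mat_adjoint) (simp_all add: n_def unitary_shift_mat)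
  have C: "unitary_mat n C"
    unfolding C_def using A WW by (intro unitary_mat_mult unitary_mat_adjoint)
  have intertwine: "A * tensor_mat (U j) (1\<^sub>m D) = tensor_mat (U j) (U j) * A" if "j < N" for j
  proof -
    have "\<omega> ^ (j * ((a + b) mod D)) = \<omega> ^ (j * a) * \<omega> ^ (j * b)" for a b
    proof -
      have "(\<omega> ^ j) ^ D = 1"
        using \<omega>D by (metis mult.commute power_mult power_one)
      then have "(\<omega> ^ j) ^ ((a + b) mod D) = (\<omega> ^ j) ^ (a + b)"
        by (rule power_mod_of_power_eq_1)
      then show ?thesis by (simp add: power_add flip: power_mult)
    qed
    then have PT: "shift_mat D * tensor_mat (\<Delta> j) (1\<^sub>m D) = tensor_mat (\<Delta> j) (\<Delta> j) * shift_mat D"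
      unfolding \<Delta>_def by (intro shift_mat_copies_phases)
    \<comment> \<open>Puts the identity into conjugated form, so that
      \<open>tensor_conjugate\<close> also covers \<open>U j\<close> tensored with the
      identity.\<close>
    have one: "1\<^sub>m D = E * 1\<^sub>m D * mat_adjoint E"
      using unitary_matD[OF E] by simp
    have c: "shift_mat D \<in> carrier_mat n n" "tensor_mat (\<Delta> j) (1\<^sub>m D) \<in> carrier_mat n n"
      "tensor_mat (\<Delta> j) (\<Delta> j) \<in> carrier_mat n n"
      using \<Delta>c[of j] by (simp_all add: n_def)
    have "tensor_mat (U j) (1\<^sub>m D) = EE * tensor_mat (\<Delta> j) (1\<^sub>m D) * mat_adjoint EE"
      unfolding U[OF that] EE_def
      by (subst one) (rule tensor_conjugate[OF Ec \<Delta>c one_carrier_mat])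
    moreover have "tensor_mat (U j) (U j) = EE * tensor_mat (\<Delta> j) (\<Delta> j) * mat_adjoint EE"
      unfolding U[OF that] EE_def by (rule tensor_conjugate[OF Ec \<Delta>c \<Delta>c])
    ultimately show ?thesis
      unfolding A_def using conjugate_mult[OF EE] c PT by simp
  qed

  \<comment> \<open>The second tensor factor on the left is the coefficient matrix of the blank
    state \<open>\<Psi>0\<close>. The scalars are the same on both sides and factor out.\<close>
  have copy: "A * tensor_mat (?c \<cdot>\<^sub>m (U j * W)) (?c \<cdot>\<^sub>m W) * C
      = tensor_mat (?c \<cdot>\<^sub>m (U j * W)) (?c \<cdot>\<^sub>m (U j * W))" if "j < N" for j
  proof -
    note Uc = unitary_matD(1)[OF Uu[OF that]]
    have c: "tensor_mat (U j) (1\<^sub>m D) \<in> carrier_mat n n" "tensor_mat (U j) (U j) \<in> carrier_mat n n"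
      using Uc by (simp_all add: n_def)
    have "tensor_mat (U j * W) W = tensor_mat (U j) (1\<^sub>m D) * WW"
      "tensor_mat (U j * W) (U j * W) = tensor_mat (U j) (U j) * WW"
      unfolding WW_def using Uc Wc by (simp_all add: tensor_mat_mult[of _ D D _ D D _ D _ D])
    moreover have "A * (tensor_mat (U j) (1\<^sub>m D) * WW) * C = tensor_mat (U j) (U j) * WW"
      unfolding C_def using A WW c intertwine[OF that] by (rule intertwiner_cancel)
    ultimately show ?thesis
      using unitary_matD(1)[OF A] unitary_matD(1)[OF WW] unitary_matD(1)[OF C] c
      by (simp add: tensor_mat_smult mult_smult_distrib[of _ n n _ n] mult_smult_assoc_mat[of _ n n _ n]
          mult_carrier_mat[of _ n n])
  qed

  obtain \<Lambda> where \<Lambda>: "locc n n n n \<Lambda>"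
    "\<And>X. X \<in> carrier_mat n n \<Longrightarrow> \<Lambda> (ketbra (vec_of_mat X) (vec_of_mat X))
      = ketbra (vec_of_mat (A * X * C)) (vec_of_mat (A * X * C))"
    using locc_local_unitaries[OF A unitary_mat_transpose[OF C]] by auto
  have "\<Lambda> (regroup D (tensor_mat (ketbra (\<Psi> j) (\<Psi> j)) (ketbra \<Psi>0 \<Psi>0)))
      = regroup D (tensor_mat (ketbra (\<Psi> j) (\<Psi> j)) (ketbra (\<Psi> j) (\<Psi> j)))" if "j < N" for j
  proof -
    have c: "?c \<cdot>\<^sub>m (U j * W) \<in> carrier_mat D D" "?c \<cdot>\<^sub>m W \<in> carrier_mat D D"
      using unitary_matD(1)[OF Uu[OF that]] Wc by auto
    have t: "tensor_mat (?c \<cdot>\<^sub>m (U j * W)) (?c \<cdot>\<^sub>m W) \<in> carrier_mat n n"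
      unfolding n_def using c by (rule tensor_mat_carrier)
    show ?thesis
      unfolding \<Psi>[OF that] \<Psi>0 regroup_product_state[OF c] regroup_product_state[OF c(1) c(1)]
        \<Lambda>(2)[OF t] copy[OF that] ..
  qed
  moreover have "\<Psi>0 \<in> carrier_vec (D * D)"
    unfolding \<Psi>0 using Wc by (auto simp: carrier_dim_vec)
  moreover have "\<Psi>0 \<bullet>c \<Psi>0 = 1"
    using assms(3,1) by (rule maximally_entangled_normalized)
  ultimately have "locally_copiable D N \<Psi>"
    unfolding locally_copiable_def using \<Lambda>(1) unfolding n_def by blast
  with max show ?thesis by blast
qed

end
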